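(* Let $N\ge 1$, $0<\lambda\le\Lambda$, and assume $\beta:=\frac{\Lambda}{\lambda}(N-1)+1>2$. Let $F:\mathbb{R}^N\times\mathrm{Sym}_N\to\mathbb{R}$ be continuous, uniformly elliptic with constants $\lambda,\Lambda$, and satisfy $F(x,0)=0$ for all $x$. Let $q>\frac{\beta}{\beta-2}$ and $1<\gamma\le\frac{\beta}{\beta-1}$. If $u:\mathbb{R}^N\to[0,\infty)$ is a nonnegative viscosity solution of $$F(x,D^2u)\ge u^q+|Du|^\gamma\quad\text{in }\mathbb{R}^N,$$ then $u$ is constant.
   Context: $\mathrm{Sym}_N$ denotes the real symmetric $N\times N$ matrices. For $M\in\mathrm{Sym}_N$ with eigenvalues $e_1,\dots,e_N$, the Pucci extremal operators are $\mathcal{M}^+_{\lambda,\Lambda}(M)=\sup_{\lambda I_N\le A\le\Lambda I_N}(-\mathrm{Tr}(AM))=-\lambda\sum_{e_k>0}e_k-\Lambda\sum_{e_k<0}e_k$ and $\mathcal{M}^-_{\lambda,\Lambda}(M)=\inf_{\lambda I_N\le A\le\Lambda I_N}(-\mathrm{Tr}(AM))=-\Lambda\sum_{e_k>0}e_k-\lambda\sum_{e_k<0}e_k$. $F$ is uniformly elliptic if $\mathcal{M}^-_{\lambda,\Lambda}(M-Q)\le F(x,M)-F(x,Q)\le\mathcal{M}^+_{\lambda,\Lambda}(M-Q)$ for all $x\in\mathbb{R}^N$, $M,Q\in\mathrm{Sym}_N$ (sign convention: $-\Delta$ is such an operator). A viscosity solution of an inequality $G(x,u,Du,D^2u)\ge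 0$ in an open set $\Omega$ (a viscosity supersolution) is a lower semicontinuous function $u$ such that for every $x_0\in\Omega$ and every $\varphi\in C^2$ for which $u-\varphi$ has a local minimum at $x_0$, one has $G(x_0,u(x_0),D\varphi(x_0),D^2\varphi(x_0))\ge0$. *)

theory Defs
  imports "HOL-Analysis.Analysis"
begin

definition Sym :: "(real^'n^'n) set" where
  "Sym = {M. transpose M = M}"

definition between_ident :: "real \<Rightarrow> real \<Rightarrow> real^'n^'n \<Rightarrow> bool" where
  "between_ident l L A \<longleftrightarrow> A \<in> Sym \<and>
     (\<forall>v::real^'n. l * (v \<bullet> v) \<le> v \<bullet> (A *v v) \<and> v \<bullet> (A *v v) \<le> L * (v \<bullet> v))"

definition mtrace :: "real^'n^'n \<Rightarrow> real" where
  "mtrace M = (\<Sum>i\<in>UNIV. M $ i $ i)"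

definition pucci_plus :: "real \<Rightarrow> real \<Rightarrow> real^'n^'n \<Rightarrow> real" where
  "pucci_plus l L M = (SUP A \<in> {A. between_ident l L A}. - mtrace (A ** M))"

definition pucci_minus :: "real \<Rightarrow> real \<Rightarrow> real^'n^'n \<Rightarrow> real" where
  "pucci_minus l L M = (INF A \<in> {A. between_ident l L A}. - mtrace (A ** M))"

definition uniformly_elliptic ::
  "real \<Rightarrow> real \<Rightarrow> (real^'n \<Rightarrow> real^'n^'n \<Rightarrow> real) \<Rightarrow> bool" where
  "uniformly_elliptic l L F \<longleftrightarrow>
     (\<forall>x M Q. M \<in> Sym \<longrightarrow> Q \<in> Sym \<longrightarrow>
        pucci_minus l L (M - Q) \<le> F x M - F x Q \<and> F x M - F x Q \<le> pucci_plus l L (M - Q))"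

definition lsc :: "(real^'n \<Rightarrow> real) \<Rightarrow> bool" where
  "lsc u \<longleftrightarrow> (\<forall>x. \<forall>t < u x. \<forall>\<^sub>F y in at x. t < u y)"

definition C2_with :: "(real^'n \<Rightarrow> real) \<Rightarrow> (real^'n \<Rightarrow> real^'n) \<Rightarrow> (real^'n \<Rightarrow> real^'n^'n) \<Rightarrow> bool" where
  "C2_with phi Dphi Hphi \<longleftrightarrow>
     (\<forall>x. (phi has_derivative (\<lambda>h. Dphi x \<bullet> h)) (at x)) \<and>
     (\<forall>x. (Dphi has_derivative (\<lambda>h. Hphi x *v h)) (at x)) \<and>
     continuous_on UNIV Hphi"

definition local_min_at :: "(real^'n \<Rightarrow> real) \<Rightarrow> real^'n \<Rightarrow> bool" where
  "local_min_at f x0 \<longleftrightarrow> (\<exists>e>0. \<forall>x\<in>ball x0 e. f x0 \<le> f x)"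

definition visc_super ::
  "(real^'n \<Rightarrow> real^'n^'n \<Rightarrow> real) \<Rightarrow> real \<Rightarrow> real \<Rightarrow> (real^'n \<Rightarrow> real) \<Rightarrow> bool" where
  "visc_super F q g u \<longleftrightarrow> lsc u \<and>
     (\<forall>x0 phi Dphi Hphi. C2_with phi Dphi Hphi \<longrightarrow> local_min_at (\<lambda>x. u x - phi x) x0 \<longrightarrow>
        F x0 (Hphi x0) \<ge> u x0 powr q + norm (Dphi x0) powr g)"

end

theory Submission
  imports Defs
begin

text \<open>
  Ellipticity and \<open>u\<^sup>q \<ge> 0\<close> give \<open>M\<^sup>+(D\<^sup>2 u) \<ge> |Du|\<^sup>\<gamma>\<close>. For every sphere around \<open>y\<close> and every
  large radius \<open>R\<close> there is a radially decreasing strict subsolution of this inequality that equals a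
  lower bound \<open>t\<close> of \<open>u\<close> on the sphere and tends to \<open>-\<infinity>\<close> at radius \<open>R\<close>; since \<open>u \<ge> 0\<close>,
  comparison puts \<open>u\<close> above it. Its slope is \<open>r\<^bsup>1-\<beta>\<^esup> z(r)\<close> with \<open>z\<close> a multiple of
  \<open>(ln (R/r))\<^bsup>-1/(\<gamma>-1)\<^esup>\<close>, and \<open>\<gamma> \<le> \<beta>/(\<beta>-1)\<close> is what allows a logarithm here, so that the slope
  tends to \<open>0\<close> locally uniformly as \<open>R \<rightarrow> \<infinity>\<close>. Hence \<open>u \<ge> t\<close> outside every sphere on which \<open>u \<ge> t\<close>.
  If \<open>u x < u y\<close>, lower semicontinuity at \<open>y\<close> gives such a small sphere with \<open>t > u x\<close>, a
  contradiction.
\<close>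

section \<open>Trace bounds and the Pucci operator on radial Hessians\<close>

text \<open>Hessians of functions of |x - y|^2 are combinations of \<open>mat 1\<close> and
  \<open>outer (x - y)\<close>.\<close>

definition outer :: "real^'n \<Rightarrow> real^'n^'n" where
  "outer v = (\<chi> i j. v $ i * v $ j)"

lemma outer_mult_vec: "outer v *v k = (v \<bullet> k) *\<^sub>R v"
  by (simp add: outer_def vec_eq_iff matrix_vector_mult_def inner_vec_def sum_distrib_left
      sum_distrib_right mult_ac)

lemma mtrace_mult_outer: "mtrace (A ** outer v) = v \<bullet> (A *v v)"
  by (simp add: mtrace_def outer_def matrix_matrix_mult_def matrix_vector_mult_def inner_vec_def
      sum_distrib_left mult_ac)

lemma mtrace_eq_trace: "mtrace M = trace M"
  by (simp add: mtrace_def trace_def)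

lemma mtrace_scaleR: "mtrace (c *\<^sub>R A) = c * mtrace A"
  by (simp add: mtrace_def sum_distrib_left)

lemma diag_eq_inner_axis: "M $ i $ i = axis i 1 \<bullet> (M *v axis i (1::real))"
  by (simp add: matrix_vector_mult_basis column_def inner_axis' )

text \<open>Complete \<open>e\<close> to an orthonormal basis, the columns of \<open>Q\<close>.
  Conjugation by \<open>Q\<close> preserves the trace, and every diagonal entry of the result is a
  Rayleigh quotient of \<open>A\<close>: one belongs to \<open>e\<close>, the others are at most
  \<open>L\<close>.\<close>

lemma mtrace_le:
  assumes A: "\<And>v::real^'n. v \<bullet> (A *v v) \<le> L * (v \<bullet> v)" and e: "norm (e::real^'n) = 1"
  shows "mtrace A \<le> L * (real CARD('n) - 1) + e \<bullet> (A *v e)"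
proof -
  fix k :: 'n
  obtain Q where Q: "orthogonal_matrix Q" "Q *v axis k 1 = e"
    using orthogonal_matrix_exists_basis[OF e] by blast
  define B where "B = transpose Q ** A ** Q"
  have diag: "B $ i $ i = (Q *v axis i 1) \<bullet> (A *v (Q *v axis i 1))" for i
    unfolding diag_eq_inner_axis B_def matrix_vector_mul_assoc [symmetric]
    by (metis dot_lmul_matrix vector_transpose_matrix)
  have "norm (Q *v axis i (1::real)) = 1" for i
    using Q(1) by (simp add: orthogonal_matrix_orthonormal_columns matrix_vector_mult_basis)
  then have le: "B $ i $ i \<le> L" for i
    unfolding diag using A[of "Q *v axis i 1"] by (simp only: dot_square_norm) simp
  have "mtrace A = mtrace B"
  proof -
    have "mtrace B = mtrace (Q ** (transpose Q ** A))"
      unfolding B_def mtrace_eq_trace by (rule trace_mul_sym)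
    then show ?thesis
      using Q(1) by (simp add: matrix_mul_assoc orthogonal_matrix_def)
  qed
  also have "\<dots> = B $ k $ k + (\<Sum>i\<in>UNIV - {k}. B $ i $ i)"
    unfolding mtrace_def by (simp add: sum.remove)
  also have "\<dots> \<le> B $ k $ k + (\<Sum>i\<in>UNIV - {k}. L)"
    by (intro add_left_mono sum_mono le)
  also have "(\<Sum>i\<in>UNIV - {k}. L) = L * (real CARD('n) - 1)"
    by (simp add: card_Diff_singleton of_nat_diff Suc_leI)
  finally show ?thesis
    using Q(2) by (simp add: diag del: matrix_vector_mult_basis)
qed

lemma between_ident_scaled_identity:
  assumes "l \<le> L"
  shows "between_ident l L (l *\<^sub>R mat 1)"
  unfolding between_ident_def Sym_def
  using assms by (auto simp: transpose_scalar scaleR_matrix_vector_assoc[symmetric]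
      intro!: mult_right_mono )

text \<open>For fixed \<open>A\<close>, the trace bound leaves an expression affine in the Rayleigh
  quotient \<open>th\<close> of \<open>A\<close> along \<open>v\<close>. Since \<open>th\<close>
  ranges over [l, L], the expression is largest at an endpoint, hence the
  \<open>max\<close>.\<close>

lemma pucci_plus_radial_le:
  fixes v :: "real^'n"
  assumes "l \<le> L" and v: "v \<noteq> 0" and "0 \<le> f"
  shows "pucci_plus l L (- (2 * f) *\<^sub>R mat 1 + (4 * c) *\<^sub>R outer v)
    \<le> 2 * f * (L * (real CARD('n) - 1))
      + max (l * (2 * f - 4 * c * (v \<bullet> v))) (L * (2 * f - 4 * c * (v \<bullet> v)))"
  unfolding pucci_plus_def
proof (rule cSUP_least)
  show "{A. between_ident l L (A::real^'n^'n)} \<noteq> {}"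
    using between_ident_scaled_identity[OF assms(1)] by blast
next
  fix A :: "real^'n^'n"
  assume "A \<in> {A. between_ident l L A}"
  then have A: "\<And>w. l * (w \<bullet> w) \<le> w \<bullet> (A *v w)" "\<And>w. w \<bullet> (A *v w) \<le> L * (w \<bullet> w)"
    by (auto simp: between_ident_def)
  define e where "e = v /\<^sub>R norm v"
  define th where "th = e \<bullet> (A *v e)"
  have e: "norm e = 1" and ve: "v = norm v *\<^sub>R e"
    using v by (auto simp: e_def)
  have ee: "e \<bullet> e = 1"
    using e by (simp add: dot_square_norm)
  have th: "l \<le> th" "th \<le> L"
    using A[of e] by (simp_all add: th_def ee)
  have "v \<bullet> (A *v v) = (v \<bullet> v) * th"
  proof -
    have "v \<bullet> (A *v v) = (norm v)\<^sup>2 * th"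
      by (subst (1 2) ve) (simp add: th_def power2_eq_square matrix_vector_mult_scaleR)
    then show ?thesis by (simp add: dot_square_norm)
  qed
  then have "- mtrace (A ** (- (2 * f) *\<^sub>R mat 1 + (4 * c) *\<^sub>R outer v))
      = 2 * f * mtrace A - 4 * c * ((v \<bullet> v) * th)"
    unfolding matrix_add_ldistrib mtrace_eq_trace trace_add
    by (simp add: matrix_scalar_ac mtrace_scaleR mtrace_mult_outer
        del: scaleR_minus_left flip: mtrace_eq_trace scalar_matrix_assoc)
  also have "\<dots> \<le> 2 * f * (L * (real CARD('n) - 1) + th) - 4 * c * ((v \<bullet> v) * th)"
    using mtrace_le[OF A(2) e] \<open>0 \<le> f\<close> by (intro diff_right_mono mult_left_mono) (auto simp: th_def)
  also have "\<dots> = 2 * f * (L * (real CARD('n) - 1)) + th * (2 * f - 4 * c * (v \<bullet> v))"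
    by (simp add: algebra_simps)
  also have "th * (2 * f - 4 * c * (v \<bullet> v))
      \<le> max (l * (2 * f - 4 * c * (v \<bullet> v))) (L * (2 * f - 4 * c * (v \<bullet> v)))"
  proof (cases "0 \<le> 2 * f - 4 * c * (v \<bullet> v)")
    case True
    then show ?thesis using th by (intro max.coboundedI2 mult_right_mono)
  next
    case False
    then show ?thesis using th by (intro max.coboundedI1 mult_right_mono_neg) auto
  qed
  finally show "- mtrace (A ** (- (2 * f) *\<^sub>R mat 1 + (4 * c) *\<^sub>R outer v))
    \<le> 2 * f * (L * (real CARD('n) - 1))
      + max (l * (2 * f - 4 * c * (v \<bullet> v))) (L * (2 * f - 4 * c * (v \<bullet> v)))"
    by simp
qed

section \<open>Radial test functions and minima of semicontinuous functions\<close>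

text \<open>Taking the squared distance as the radial variable keeps the composition smooth at the
  centre \<open>y\<close> as well, as \<open>C2_with\<close> requires.\<close>

lemma C2_with_radial:
  fixes y :: "real^'n"
  assumes h: "\<And>s. (h has_real_derivative h1 s) (at s)"
    and h1: "\<And>s. (h1 has_real_derivative h2 s) (at s)"
    and h2: "continuous_on UNIV h2"
  shows "C2_with (\<lambda>x. h ((x - y) \<bullet> (x - y)))
    (\<lambda>x. (2 * h1 ((x - y) \<bullet> (x - y))) *\<^sub>R (x - y))
    (\<lambda>x. (2 * h1 ((x - y) \<bullet> (x - y))) *\<^sub>R mat 1 + (4 * h2 ((x - y) \<bullet> (x - y))) *\<^sub>R outer (x - y))"
  unfolding C2_with_def
proof (intro conjI allI)
  fix x :: "real^'n"
  have s: "((\<lambda>x. (x - y) \<bullet> (x - y)) has_derivative (\<lambda>k. 2 * ((x - y) \<bullet> k))) (at x)"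
    by (auto intro!: derivative_eq_intros simp: inner_commute)
  show "((\<lambda>x. h ((x - y) \<bullet> (x - y))) has_derivative
      (\<bullet>) ((2 * h1 ((x - y) \<bullet> (x - y))) *\<^sub>R (x - y))) (at x)"
    by (rule has_derivative_eq_rhs [OF has_derivative_compose[OF s h[unfolded has_field_derivative_def]]])
      (simp add: fun_eq_iff)
  have "((\<lambda>x. h1 ((x - y) \<bullet> (x - y))) has_derivative
      (\<lambda>k. 2 * h2 ((x - y) \<bullet> (x - y)) * ((x - y) \<bullet> k))) (at x)"
    by (rule has_derivative_eq_rhs [OF has_derivative_compose[OF s h1[unfolded has_field_derivative_def]]])
      (simp add: fun_eq_iff)
  then show "((\<lambda>x. (2 * h1 ((x - y) \<bullet> (x - y))) *\<^sub>R (x - y)) has_derivative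
      (*v) ((2 * h1 ((x - y) \<bullet> (x - y))) *\<^sub>R mat 1 + (4 * h2 ((x - y) \<bullet> (x - y))) *\<^sub>R outer (x - y))) (at x)"
    by (auto intro!: derivative_eq_intros
        simp: matrix_vector_mult_add_rdistrib scaleR_matrix_vector_assoc[symmetric] outer_mult_vec)
next
  have "continuous_on UNIV h1"
    using h1 by (meson DERIV_isCont continuous_at_imp_continuous_on)
  then have "continuous_on UNIV (\<lambda>x. h1 ((x - y) \<bullet> (x - y)))" "continuous_on UNIV (\<lambda>x. h2 ((x - y) \<bullet> (x - y)))"
    using h2 by (auto intro!: continuous_on_compose2[of UNIV h1]
        continuous_on_compose2[of UNIV h2] continuous_intros)
  then show "continuous_on UNIV (\<lambda>x. (2 * h1 ((x - y) \<bullet> (x - y))) *\<^sub>R mat 1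
      + (4 * h2 ((x - y) \<bullet> (x - y))) *\<^sub>R outer (x - y))"
    unfolding outer_def by (intro continuous_intros)
qed

text \<open>If no minimum existed, each \<open>x\<close> in \<open>K\<close> would have a
  neighbourhood on which \<open>u - v\<close> exceeds its value at some \<open>z x\<close> in
  \<open>K\<close>. Among the finitely many \<open>z x\<close> of a finite subcover, one with least
  value lies in a member of that subcover, which yields a smaller value.\<close>

lemma lsc_minus_continuous_attains_min:
  fixes u v :: "real^'n \<Rightarrow> real"
  assumes u: "lsc u" and K: "compact K" "K \<noteq> {}" and v: "continuous_on K v"
  obtains x where "x \<in> K" "\<And>z. z \<in> K \<Longrightarrow> u x - v x \<le> u z - v z"
proof -
  have "\<exists>x\<in>K. \<forall>z\<in>K. u x - v x \<le> u z - v z"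
  proof (rule ccontr)
    assume "\<not> ?thesis"
    then have "\<forall>x\<in>K. \<exists>z\<in>K. u z - v z < u x - v x" by (auto simp: not_le)
    then obtain z where z: "\<And>x. x \<in> K \<Longrightarrow> z x \<in> K \<and> u (z x) - v (z x) < u x - v x"
      by metis
    have nbhd: "\<exists>T. open T \<and> x \<in> T \<and> (\<forall>p\<in>T \<inter> K. u (z x) - v (z x) < u p - v p)" if xK: "x \<in> K" for x
    proof -
      \<comment> \<open>Half of the gap: semicontinuity of \<open>u\<close> and continuity of
        \<open>v\<close> may each lose one half.\<close>
      define d where "d = (u x - v x - (u (z x) - v (z x))) / 2"
      have d: "d > 0" using z[OF xK] by (simp add: d_def)
      have "\<forall>\<^sub>F p in at x. u x - d < u p"
        by (rule u[unfolded lsc_def, rule_format]) (use d in simp)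
      then obtain T1 where T1: "open T1" "x \<in> T1" "\<And>p. p \<in> T1 \<Longrightarrow> p \<noteq> x \<Longrightarrow> u x - d < u p"
        unfolding eventually_at_topological by (elim exE conjE) (rule that, auto)
      obtain r where r: "r > 0" "\<And>p. p \<in> K \<Longrightarrow> dist p x < r \<Longrightarrow> dist (v p) (v x) < d"
        using v[unfolded continuous_on_iff, rule_format, OF xK d] by auto
      define T2 where "T2 = ball x r"
      have T2: "open T2" "x \<in> T2" "\<And>p. p \<in> T2 \<Longrightarrow> p \<in> K \<Longrightarrow> dist (v p) (v x) < d"
        using r by (auto simp: T2_def dist_commute)
      show ?thesis
      proof (intro exI[of _ "T1 \<inter> T2"] conjI ballI)
        fix p assume p: "p \<in> T1 \<inter> T2 \<inter> K"
        \<comment> \<open>The filter \<open>at x\<close> is punctured, so \<open>p = x\<close> is a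
          separate case.\<close>
        then have "u x - d < u p" "v p - v x < d"
          using T1(3)[of p] T2(3)[of p] d by (cases "p = x"; simp add: dist_real_def)+
        then show "u (z x) - v (z x) < u p - v p"
          unfolding d_def by (simp add: field_simps)
      qed (use T1 T2 in auto)
    qed
    have "\<forall>x\<in>K. \<exists>T. open T \<and> x \<in> T \<and> (\<forall>p\<in>T \<inter> K. u (z x) - v (z x) < u p - v p)"
      using nbhd by blast
    from bchoice[OF this] obtain T
      where T: "\<forall>x\<in>K. open (T x) \<and> x \<in> T x \<and> (\<forall>p\<in>T x \<inter> K. u (z x) - v (z x) < u p - v p)"
      by blast
    obtain C where C: "C \<subseteq> K" "finite C" "K \<subseteq> (\<Union>x\<in>C. T x)"
      using compactE_image[OF K(1), of K T] T by blast
    have "C \<noteq> {}" using C K by auto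
    define m where "m = Min ((\<lambda>x. u (z x) - v (z x)) ` C)"
    have "m \<in> (\<lambda>x. u (z x) - v (z x)) ` C"
      unfolding m_def using C \<open>C \<noteq> {}\<close> by (intro Min_in) auto
    then obtain c where c: "c \<in> C" "m = u (z c) - v (z c)" by auto
    have "z c \<in> K" using c C z by auto
    then obtain b where b: "b \<in> C" "z c \<in> T b" using C by auto
    then have "u (z b) - v (z b) < m" using T C b(1) b(2) \<open>z c \<in> K\<close> c by auto
    moreover have "m \<le> u (z b) - v (z b)" unfolding m_def using C b by auto
    ultimately show False by simp
  qed
  then show ?thesis using that by blast
qed

section \<open>Touching a barrier from below by quadratics\<close>

text \<open>The second derivative of \<open>h\<close> at \<open>s0\<close> is - f'; the quadratic
  has it lowered by 2d. Differentiability of \<open>f\<close> at \<open>s0\<close> bounds the error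
  in the derivative of the difference \<open>k\<close> by d |s - s0|, which the term 2d (s - s0)
  dominates. So \<open>k\<close> falls to the left of \<open>s0\<close>, rises to the right, and
  vanishes at \<open>s0\<close>.\<close>

lemma quadratic_below_at:
  fixes h f :: "real \<Rightarrow> real"
  assumes "0 < e" and h: "\<And>s. \<bar>s - s0\<bar> < e \<Longrightarrow> (h has_real_derivative - f s) (at s)"
    and f: "(f has_real_derivative f') (at s0)" and "0 < d"
  obtains r where "0 < r"
    "\<And>s. \<bar>s - s0\<bar> < r \<Longrightarrow> h s0 - f s0 * (s - s0) + (- f' - 2 * d) / 2 * (s - s0)\<^sup>2 \<le> h s"
proof -
  obtain r1 where r1: "r1 > 0" "\<And>s. \<bar>s - s0\<bar> < r1 \<Longrightarrow> \<bar>f s - f s0 - f' * (s - s0)\<bar> \<le> d * \<bar>s - s0\<bar>"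
    using f[unfolded has_field_derivative_def has_derivative_at_alt] \<open>0 < d\<close>
    by (auto simp: mult.commute)
  define k where "k s = h s - (h s0 - f s0 * (s - s0) + (- f' - 2 * d) / 2 * (s - s0)\<^sup>2)" for s
  define r where "r = min e r1"
  have k': "(k has_real_derivative - (f s - f s0 - f' * (s - s0)) + 2 * d * (s - s0)) (at s)"
    if "\<bar>s - s0\<bar> < r" for s
    unfolding k_def using that
    by (auto intro!: derivative_eq_intros h simp: r_def field_simps)
  have "0 \<le> k s" if s: "\<bar>s - s0\<bar> < r" for s
  proof (cases "s0 \<le> s")
    case True
    have "k s0 \<le> k s"
    proof (rule DERIV_nonneg_imp_nondecreasing[OF True])
      fix z assume z: "s0 \<le> z" "z \<le> s"
      then have "\<bar>f z - f s0 - f' * (z - s0)\<bar> \<le> d * (z - s0)"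
        using r1(2)[of z] s by (auto simp: r_def)
      moreover have "0 \<le> d * (z - s0)" using z \<open>0 < d\<close> by simp
      ultimately have "0 \<le> - (f z - f s0 - f' * (z - s0)) + 2 * d * (z - s0)"
        by linarith
      then show "\<exists>y. (k has_real_derivative y) (at z) \<and> 0 \<le> y"
        using k'[of z] z s by auto
    qed
    then show ?thesis by (simp add: k_def)
  next
    case False
    then have "s \<le> s0" by simp
    then have "k s0 \<le> k s"
    proof (rule DERIV_nonpos_imp_nonincreasing)
      fix z assume z: "s \<le> z" "z \<le> s0"
      then have "\<bar>f z - f s0 - f' * (z - s0)\<bar> \<le> d * (s0 - z)"
        using r1(2)[of z] s by (auto simp: r_def)
      moreover have "0 \<le> d * (s0 - z)" using z \<open>0 < d\<close> by simp
      moreover have "2 * d * (z - s0) = - 2 * (d * (s0 - z))" by (simp add: algebra_simps)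
      ultimately have "- (f z - f s0 - f' * (z - s0)) + 2 * d * (z - s0) \<le> 0"
        by linarith
      then show "\<exists>y. (k has_real_derivative y) (at z) \<and> y \<le> 0"
        using k'[of z] z s by auto
    qed
    then show ?thesis by (simp add: k_def)
  qed
  then show ?thesis
    using that[of r] \<open>0 < e\<close> r1(1) by (auto simp: r_def k_def)
qed

lemma Sym_radial: "a *\<^sub>R mat 1 + b *\<^sub>R outer v \<in> Sym"
  by (simp add: Sym_def transpose_def outer_def mat_def vec_eq_iff mult.commute)

text \<open>Test functions must be \<open>C\<^sup>2\<close> on the whole space, whereas the barriers are only defined on an
  annulus; they are replaced by quadratic polynomials in \<open>|x - y|\<^sup>2\<close> touching them from below.\<close>

lemma visc_super_radial_test:
  fixes F :: "real^'n \<Rightarrow> real^'n^'n \<Rightarrow> real" and x0 y :: "real^'n"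
  assumes l: "0 < l" "l \<le> L" and ell: "uniformly_elliptic l L F" and F0: "\<forall>x. F x 0 = 0"
    and u: "visc_super F q g u"
    and s0: "s0 = (x0 - y) \<bullet> (x0 - y)" "0 < s0"
    and min: "local_min_at (\<lambda>x. u x - h ((x - y) \<bullet> (x - y))) x0"
    and "0 < e" and h: "\<And>s. \<bar>s - s0\<bar> < e \<Longrightarrow> (h has_real_derivative - f s) (at s)"
    and f: "(f has_real_derivative f') (at s0)" and f0: "0 \<le> f s0"
  shows "(2 * f s0 * sqrt s0) powr g \<le> 2 * f s0 * (L * (real CARD('n) - 1))
    + max (l * (2 * f s0 + 4 * s0 * f')) (L * (2 * f s0 + 4 * s0 * f'))"
proof (rule field_le_epsilon)
  fix \<epsilon> :: real assume "0 < \<epsilon>"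
  have "0 < L" using l by simp
  \<comment> \<open>Lowering the second derivative by 2d adds 8 d s0 = \<epsilon> / L inside the
    \<open>max\<close>; a factor of at most \<open>L\<close> turns this into at most
    \<epsilon>.\<close>
  define d where "d = \<epsilon> / (8 * L * s0)"
  have "0 < d" using \<open>0 < \<epsilon>\<close> \<open>0 < L\<close> s0(2) by (simp add: d_def)
  define c where "c = - f' - 2 * d"
  define p where "p s = h s0 - f s0 * (s - s0) + c / 2 * (s - s0)\<^sup>2" for s
  define p1 where "p1 s = - f s0 + c * (s - s0)" for s
  have p: "(p has_real_derivative p1 s) (at s)" for s
    unfolding p_def p1_def by (auto intro!: derivative_eq_intros)
  have p1: "(p1 has_real_derivative c) (at s)" for s
    unfolding p1_def by (auto intro!: derivative_eq_intros)
  obtain r where r: "0 < r" "\<And>s. \<bar>s - s0\<bar> < r \<Longrightarrow> p s \<le> h s"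
    unfolding p_def c_def using quadratic_below_at[OF \<open>0 < e\<close> h f \<open>0 < d\<close>] by blast
  \<comment> \<open>\<open>p\<close> lies below \<open>h\<close> near \<open>s0\<close> and agrees
    with it at \<open>s0\<close>, so the local minimum is inherited.\<close>
  have "local_min_at (\<lambda>x. u x - p ((x - y) \<bullet> (x - y))) x0"
  proof -
    obtain e1 where e1: "e1 > 0" "\<And>x. x \<in> ball x0 e1 \<Longrightarrow> u x0 - h s0 \<le> u x - h ((x - y) \<bullet> (x - y))"
      using min by (auto simp: local_min_at_def s0(1))
    have "isCont (\<lambda>x. (x - y) \<bullet> (x - y)) x0" by (intro continuous_intros)
    then obtain e2 where e2: "e2 > 0" "\<And>x. dist x x0 < e2 \<Longrightarrow> \<bar>(x - y) \<bullet> (x - y) - s0\<bar> < r"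
      using r(1) unfolding continuous_at_eps_delta s0(1) dist_real_def by metis
    have "u x0 - p s0 \<le> u x - p ((x - y) \<bullet> (x - y))" if "x \<in> ball x0 (min e1 e2)" for x
      using e1(2)[of x] r(2)[OF e2(2)[of x]] that by (auto simp: p_def dist_commute)
    then show ?thesis
      unfolding local_min_at_def s0(1) using e1(1) e2(1)
      by (intro exI[of _ "min e1 e2"]) auto
  qed
  moreover define H where "H = (2 * p1 s0) *\<^sub>R mat 1 + (4 * c) *\<^sub>R outer (x0 - y)"
  note C2_with_radial[OF p p1 continuous_on_const, of y]
  ultimately have "u x0 powr q + norm ((2 * p1 s0) *\<^sub>R (x0 - y)) powr g \<le> F x0 H"
    using u unfolding visc_super_def H_def s0(1) by blast
  then have "norm ((2 * p1 s0) *\<^sub>R (x0 - y)) powr g \<le> F x0 H"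
    using powr_ge_zero[of "u x0" q] by linarith
  moreover have "norm ((2 * p1 s0) *\<^sub>R (x0 - y)) = 2 * f s0 * sqrt s0"
    using f0 by (simp add: p1_def s0(1) norm_eq_sqrt_inner[of "x0 - y"])
  moreover have "F x0 H \<le> pucci_plus l L H"
  proof -
    have "H \<in> Sym" "(0::real^'n^'n) \<in> Sym"
      unfolding H_def by (rule Sym_radial) (simp add: Sym_def transpose_def vec_eq_iff)
    then have "F x0 H - F x0 0 \<le> pucci_plus l L (H - 0)"
      using ell unfolding uniformly_elliptic_def by blast
    then show ?thesis using F0 by simp
  qed
  moreover have "pucci_plus l L H \<le> 2 * f s0 * (L * (real CARD('n) - 1))
    + max (l * (2 * f s0 - 4 * c * s0)) (L * (2 * f s0 - 4 * c * s0))"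
    using pucci_plus_radial_le[OF l(2), of "x0 - y" "f s0" c] s0 f0
    by (auto simp: H_def p1_def)
  moreover have "2 * f s0 - 4 * c * s0 = (2 * f s0 + 4 * s0 * f') + \<epsilon> / L"
    using \<open>0 < L\<close> s0(2) by (simp add: c_def d_def field_simps)
  moreover have "max (l * (X + \<epsilon> / L)) (L * (X + \<epsilon> / L)) \<le> max (l * X) (L * X) + \<epsilon>" for X
  proof -
    have "l * (\<epsilon> / L) \<le> \<epsilon>"
      using l \<open>0 < \<epsilon>\<close> \<open>0 < L\<close> by (simp add: field_simps)
    then show ?thesis using \<open>0 < L\<close> by (auto simp: distrib_left max_def)
  qed
  ultimately show "(2 * f s0 * sqrt s0) powr g \<le> 2 * f s0 * (L * (real CARD('n) - 1))
    + max (l * (2 * f s0 + 4 * s0 * f')) (L * (2 * f s0 + 4 * s0 * f')) + \<epsilon>"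
    by (smt (verit, ccfv_threshold))
qed

section \<open>Comparison with radial barriers on an annulus\<close>

text \<open>The barrier is \<open>h\<close> of the squared distance, with h' = - f. A negative
  minimum of \<open>u\<close> minus the barrier over a closed annulus would be interior, where the
  viscosity inequality contradicts \<open>strict\<close>. The bound \<open>blowup\<close> has a
  divergent integral, so \<open>h\<close> becomes nonpositive before \<open>S\<close>, which secures
  the outer boundary.\<close>

lemma radial_comparison:
  fixes F :: "real^'n \<Rightarrow> real^'n^'n \<Rightarrow> real" and y :: "real^'n"
  defines "\<sigma> \<equiv> \<lambda>x. (x - y) \<bullet> (x - y)"
  assumes l: "0 < l" "l \<le> L" and ell: "uniformly_elliptic l L F" and F0: "\<forall>x. F x 0 = 0"
    and u: "visc_super F q g u" and u0: "\<forall>x. 0 \<le> u x"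
    and s0: "0 < s0"
    and f': "\<And>s. s0 \<le> s \<Longrightarrow> s < S \<Longrightarrow> (f has_real_derivative f' s) (at s)"
    and f0: "\<And>s. s0 \<le> s \<Longrightarrow> s < S \<Longrightarrow> 0 \<le> f s"
    and strict: "\<And>s. s0 \<le> s \<Longrightarrow> s < S \<Longrightarrow> 2 * f s * (L * (real CARD('n) - 1))
      + max (l * (2 * f s + 4 * s * f' s)) (L * (2 * f s + 4 * s * f' s)) < (2 * f s * sqrt s) powr g"
    and blowup: "0 < C" "\<And>s. s0 \<le> s \<Longrightarrow> s < S \<Longrightarrow> C / (S - s) \<le> f s"
    and sphere: "\<And>x. \<sigma> x = s0 \<Longrightarrow> t \<le> u x"
    and x1: "s0 \<le> \<sigma> x1" "\<sigma> x1 < S"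
  shows "t - integral {s0..\<sigma> x1} f \<le> u x1"
proof (rule ccontr)
  assume neg: "\<not> ?thesis"
  define h where "h s = t - integral {s0..s} f" for s
  have "s0 < S" using x1 by simp
  have cont_f: "continuous_on {s0..b} f" if "b < S" for b
    using f' that by (intro DERIV_continuous_on[where D = f']) (fastforce intro: has_field_derivative_at_within)
  have h'_within: "(h has_real_derivative - f s) (at s within {s0..b})" if "s0 \<le> s" "s \<le> b" "b < S" for s b
    unfolding h_def using integral_has_real_derivative[OF cont_f[OF that(3)], of s] that
    by (auto intro!: derivative_eq_intros)
  have h': "(h has_real_derivative - f s) (at s)" if "s0 < s" "s < S" for s
    using h'_within[of s "(s + S) / 2"] that by (simp add: at_within_Icc_at)
  \<comment> \<open>The first bound on S - S1 gives C ln ((S - s0) / (S - S1)) \<ge> |t|, hence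
    \<open>h S1 \<le> 0\<close>; the second keeps \<open>x1\<close> inside the annulus.\<close>
  define S1 where "S1 = S - min ((S - s0) * exp (- \<bar>t\<bar> / C)) ((S - \<sigma> x1) / 2)"
  have S1: "\<sigma> x1 < S1" "S1 < S"
    unfolding S1_def
    using x1(2) \<open>s0 < S\<close> min.cobounded2[of "(S - s0) * exp (- \<bar>t\<bar> / C)" "(S - \<sigma> x1) / 2"]
    by (argo, simp)
  have "h S1 \<le> 0"
  proof -
    have "((\<lambda>s. C / (S - s)) has_integral (- C * ln (S - S1)) - (- C * ln (S - s0))) {s0..S1}"
      using S1 x1 by (intro fundamental_theorem_of_calculus)
        (auto intro!: derivative_eq_intros simp flip: has_real_derivative_iff_has_vector_derivative)
    moreover have "(f has_integral integral {s0..S1} f) {s0..S1}"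
      using cont_f[OF S1(2)] by (intro integrable_integral integrable_continuous_interval)
    ultimately have "(- C * ln (S - S1)) - (- C * ln (S - s0)) \<le> integral {s0..S1} f"
      by (rule has_integral_le) (use blowup(2) S1(2) in auto)
    moreover have "ln (S - S1) \<le> ln ((S - s0) * exp (- \<bar>t\<bar> / C))"
      using S1 \<open>s0 < S\<close> by (intro ln_mono) (auto simp: S1_def)
    then have "C * ln (S - S1) \<le> C * (ln (S - s0) - \<bar>t\<bar> / C)"
      using \<open>s0 < S\<close> blowup(1) by (simp add: ln_mult)
    then have "C * ln (S - S1) \<le> C * ln (S - s0) - \<bar>t\<bar>"
      using blowup(1) by (simp add: right_diff_distrib)
    ultimately show ?thesis using abs_ge_self[of t] unfolding h_def by linarith
  qed
  define K where "K = cball y (sqrt S1) \<inter> {x. s0 \<le> \<sigma> x}"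
  have K: "x \<in> K \<longleftrightarrow> s0 \<le> \<sigma> x \<and> \<sigma> x \<le> S1" for x
  proof -
    have "dist y x = sqrt (\<sigma> x)"
      unfolding \<sigma>_def by (subst dist_commute) (simp add: dist_norm norm_eq_sqrt_inner)
    then show ?thesis by (auto simp: K_def)
  qed
  have cont_\<sigma>: "continuous_on A \<sigma>" for A
    unfolding \<sigma>_def by (intro continuous_intros)
  have "compact K"
    unfolding K_def by (intro compact_Int_closed compact_cball closed_Collect_le continuous_on_const cont_\<sigma>)
  have "continuous_on {s0..S1} h"
    using h'_within[OF _ _ S1(2)] by (intro DERIV_continuous_on[where D = "\<lambda>s. - f s"]) auto
  then have "continuous_on K (\<lambda>x. h (\<sigma> x))"
    using K by (intro continuous_on_compose2[OF _ cont_\<sigma>]) auto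
  moreover have "lsc u" using u by (simp add: visc_super_def)
  moreover have "x1 \<in> K" using K x1 S1 by auto
  ultimately obtain x0 where x0: "x0 \<in> K" "\<And>z. z \<in> K \<Longrightarrow> u x0 - h (\<sigma> x0) \<le> u z - h (\<sigma> z)"
    using lsc_minus_continuous_attains_min[OF _ \<open>compact K\<close>, of u "\<lambda>x. h (\<sigma> x)"] by blast
  have "u x0 - h (\<sigma> x0) < 0"
    using x0(2)[OF \<open>x1 \<in> K\<close>] neg by (simp add: h_def)
  \<comment> \<open>On the inner sphere \<open>h\<close> is \<open>t\<close>, a lower bound of
    \<open>u\<close>; on the outer one it is at most 0, again a lower bound of
    \<open>u\<close>.\<close>
  then have "\<sigma> x0 \<noteq> s0" "\<sigma> x0 \<noteq> S1"
    using sphere[of x0] u0[rule_format, of x0] \<open>h S1 \<le> 0\<close> by (auto simp: h_def)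
  then have s: "s0 < \<sigma> x0" "\<sigma> x0 < S1"
    using x0(1) K by auto
  have "open {x. s0 < \<sigma> x \<and> \<sigma> x < S1}"
    by (intro open_Collect_conj open_Collect_less continuous_on_const cont_\<sigma>)
  then obtain e0 where e0: "e0 > 0" "ball x0 e0 \<subseteq> {x. s0 < \<sigma> x \<and> \<sigma> x < S1}"
    using s by (metis (no_types, lifting) mem_Collect_eq openE)
  have min: "local_min_at (\<lambda>x. u x - h ((x - y) \<bullet> (x - y))) x0"
    unfolding local_min_at_def
  proof (intro exI[of _ e0] conjI ballI)
    fix x assume "x \<in> ball x0 e0"
    then have "x \<in> K" using e0(2) K by force
    then show "u x0 - h ((x0 - y) \<bullet> (x0 - y)) \<le> u x - h ((x - y) \<bullet> (x - y))"
      using x0(2) by (simp add: \<sigma>_def)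
  qed (fact e0)
  have "(2 * f (\<sigma> x0) * sqrt (\<sigma> x0)) powr g \<le> 2 * f (\<sigma> x0) * (L * (real CARD('n) - 1))
    + max (l * (2 * f (\<sigma> x0) + 4 * \<sigma> x0 * f' (\<sigma> x0))) (L * (2 * f (\<sigma> x0) + 4 * \<sigma> x0 * f' (\<sigma> x0)))"
  proof (rule visc_super_radial_test[OF l ell F0 u _ _ min])
    show "0 < min (\<sigma> x0 - s0) (S - \<sigma> x0)" using s S1 by auto
    show "(h has_real_derivative - f z) (at z)" if "\<bar>z - \<sigma> x0\<bar> < min (\<sigma> x0 - s0) (S - \<sigma> x0)" for z
      using that by (intro h') auto
    show "(f has_real_derivative f' (\<sigma> x0)) (at (\<sigma> x0))" "0 \<le> f (\<sigma> x0)"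
      using f' f0 s S1 by auto
  qed (use s s0 in \<open>auto simp: \<sigma>_def\<close>)
  then show False
    using strict[of "\<sigma> x0"] s S1 by auto
qed

section \<open>The explicit barrier and its limit for large radius\<close>

text \<open>For each S > \<sigma> x1 comparison bounds \<open>u x1\<close> below by \<open>t\<close>
  minus the drop of the barrier between \<open>s0\<close> and \<sigma> x1. This drop is at most a
  constant times \<open>W S (\<sigma> x1)\<close>, which vanishes as S tends to infinity.\<close>

lemma sphere_bound_imp_exterior_bound:
  fixes F :: "real^'n \<Rightarrow> real^'n^'n \<Rightarrow> real" and y :: "real^'n"
  defines "\<sigma> \<equiv> \<lambda>x. (x - y) \<bullet> (x - y)"
  assumes l: "0 < l" "l \<le> L" and ell: "uniformly_elliptic l L F" and F0: "\<forall>x. F x 0 = 0"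
    and u: "visc_super F q g u" and u0: "\<forall>x. 0 \<le> u x"
    and b: "b = L / l * (real CARD('n) - 1) + 1" "b > 2"
    and g: "1 < g" "g \<le> b / (b - 1)"
    and s0: "0 < s0"
    and sphere: "\<And>x. \<sigma> x = s0 \<Longrightarrow> t \<le> u x"
    and x1: "s0 \<le> \<sigma> x1"
  shows "t \<le> u x1"
proof -
  have "0 < L" using l by simp
  define a where "a = 1 / (g - 1)"
  \<comment> \<open>The power of \<open>s\<close> left over when the gradient term is divided by
    s^(- b/2) W^g, up to a constant. Its being nonnegative is exactly g \<le> b / (b - 1).\<close>
  define \<kappa> where "\<kappa> = (g - b * (g - 1)) / 2"
  \<comment> \<open>Chosen so that 4 L c = s0^\<kappa> / 1, which is at most s^\<kappa> for all s
    \<ge> s0; then \<open>K\<close> is fixed by a K = c, which gives the equation for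
    \<open>W\<close>.\<close>
  define c where "c = s0 powr \<kappa> / (4 * L)"
  define K where "K = c * (g - 1)"
  have "\<kappa> \<ge> 0" using g b(2) by (simp add: \<kappa>_def field_simps)
  \<comment> \<open>This forces a \<ge> 1, so that \<open>W\<close>, of order (S - s)^(-a) near
    \<open>S\<close>, has a divergent integral there.\<close>
  have "g < 2"
  proof -
    have "b / (b - 1) < 2" using b(2) by (simp add: field_simps)
    then show ?thesis using g by simp
  qed
  then have "1 \<le> a" using g by (simp add: a_def field_simps)
  have "0 < c" "0 < K" using s0 \<open>0 < L\<close> g by (auto simp: c_def K_def)
  have aK: "a * K = c" using g by (simp add: a_def K_def)
  have ag: "- a - 1 = - a * g" using g by (simp add: a_def field_simps)
  \<comment> \<open>In the radius \<open>r = sqrt s\<close> the derivative of the barrier is \<open>- 2 * r * f S s = - 2 * W * r powr (1 - b)\<close>,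
    where \<open>r powr (1 - b)\<close> comes from the fundamental solution \<open>r powr (2 - b)\<close> of the Pucci
    operator and \<open>W\<close> solves \<open>s * W' = c * W powr g\<close>, blowing up at \<open>s = S\<close>.\<close>
  define W where "W S s = (K * ln (S / s)) powr - a" for S s
  define f where "f S s = s powr (- b / 2) * W S s" for S s
  define f' where "f' S s = s powr (- b / 2) / s * (- b / 2 * W S s + c * W S s powr g)" for S s
  have pos: "0 < K * ln (S / s)" if "0 < s" "s < S" for S s
    using that \<open>0 < K\<close> by simp
  have W: "(W S has_real_derivative c * W S s powr g / s) (at s)" if "0 < s" "s < S" for S s
  proof -
    have "((\<lambda>s. K * ln (S / s)) has_real_derivative - K / s) (at s)"
      using that by (auto intro!: derivative_eq_intros simp: power2_eq_square)
    from DERIV_chain2[OF has_real_derivative_powr[OF pos[OF that], of "- a"] this]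
    have "(W S has_real_derivative - a * (K * ln (S / s)) powr (- a - 1) * (- K / s)) (at s)"
      unfolding W_def .
    moreover have "- a * (K * ln (S / s)) powr (- a - 1) * (- K / s) = c * W S s powr g / s"
      unfolding W_def powr_powr ag aK[symmetric] by simp
    ultimately show ?thesis by (rule DERIV_cong)
  qed
  have f': "(f S has_real_derivative f' S s) (at s)" if "0 < s" "s < S" for S s
  proof -
    have "((\<lambda>s. s powr (- b / 2)) has_real_derivative - b / 2 * (s powr (- b / 2) / s)) (at s)"
      using has_real_derivative_powr[OF that(1), of "- b / 2"] that(1)
      by (simp add: powr_diff)
    from DERIV_mult[OF this W[OF that]] show ?thesis
      unfolding f_def
      by (rule DERIV_cong) (use that in \<open>simp add: f'_def field_simps\<close>)
  qed
  have strict: "2 * f S s * (L * (real CARD('n) - 1))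
      + max (l * (2 * f S s + 4 * s * f' S s)) (L * (2 * f S s + 4 * s * f' S s)) < (2 * f S s * sqrt s) powr g"
    if s: "s0 \<le> s" "s < S" for S s
  proof -
    define P where "P = s powr (- b / 2)"
    define w where "w = W S s"
    have "0 < s" using s s0 by simp
    have "0 < P" "0 < w" using \<open>0 < s\<close> pos[of s S] s by (auto simp: P_def w_def W_def)
    have fPw: "f S s = P * w" by (simp add: f_def P_def w_def)
    have X: "2 * f S s + 4 * s * f' S s = P * (- 2 * (b - 1) * w + 4 * c * w powr g)"
      using \<open>0 < s\<close> by (simp add: f_def f'_def P_def w_def field_simps)
    have LN: "L * (real CARD('n) - 1) = l * (b - 1)"
      using l by (simp add: b(1))
    \<comment> \<open>The terms linear in \<open>w\<close> cancel for \<open>\<theta> = l\<close> and are nonpositive for \<open>\<theta> > l\<close>.\<close>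
    have le: "2 * f S s * (L * (real CARD('n) - 1)) + \<theta> * (2 * f S s + 4 * s * f' S s)
        \<le> 4 * L * c * P * w powr g" if "l \<le> \<theta>" "\<theta> \<le> L" for \<theta>
    proof -
      have "2 * f S s * (L * (real CARD('n) - 1)) + \<theta> * (2 * f S s + 4 * s * f' S s)
        = 4 * c * P * w powr g * \<theta> - 2 * P * w * (b - 1) * (\<theta> - l)"
        unfolding LN X by (simp add: f_def P_def w_def algebra_simps)
      also have "\<dots> \<le> 4 * c * P * w powr g * L"
      proof -
        have "0 \<le> 2 * P * w * (b - 1) * (\<theta> - l)"
          using \<open>0 < P\<close> \<open>0 < w\<close> b(2) that by simp
        moreover have "4 * c * P * w powr g * \<theta> \<le> 4 * c * P * w powr g * L"
          using \<open>0 < P\<close> \<open>0 < c\<close> that by (intro mult_left_mono) auto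
        ultimately show ?thesis by linarith
      qed
      finally show ?thesis by (simp add: mult_ac)
    qed
    have "P powr (g - 1) * sqrt s powr g = s powr \<kappa>"
      using \<open>0 < s\<close> by (simp add: P_def powr_half_sqrt[symmetric] powr_powr powr_add[symmetric] \<kappa>_def field_simps)
    moreover have "P powr g = P * P powr (g - 1)"
      using \<open>0 < P\<close> by (simp add: powr_diff)
    ultimately have "(2 * f S s * sqrt s) powr g = 2 powr g * (P * w powr g * s powr \<kappa>)"
      using \<open>0 < P\<close> \<open>0 < w\<close> \<open>0 < s\<close>
      by (simp add: fPw powr_mult mult_ac)
    \<comment> \<open>The strict inequality comes from the factor 2^g > 1 alone.\<close>
    moreover have "1 * (P * w powr g * s powr \<kappa>) < 2 powr g * (P * w powr g * s powr \<kappa>)"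
      using \<open>0 < P\<close> \<open>0 < w\<close> \<open>0 < s\<close> g by (intro mult_strict_right_mono) auto
    ultimately have "P * w powr g * s powr \<kappa> < (2 * f S s * sqrt s) powr g"
      by linarith
    moreover have "4 * L * c * P * w powr g \<le> P * w powr g * s powr \<kappa>"
    proof -
      have "4 * L * c \<le> s powr \<kappa>"
        using \<open>0 < L\<close> s s0 \<open>\<kappa> \<ge> 0\<close> by (simp add: c_def powr_mono2)
      then have "(P * w powr g) * (4 * L * c) \<le> (P * w powr g) * s powr \<kappa>"
        using \<open>0 < P\<close> by (intro mult_left_mono) auto
      then show ?thesis by (simp add: mult_ac)
    qed
    ultimately show ?thesis
      using le[of l] le[of L] l by (simp add: max_def)
  qed
  define s1 where "s1 = \<sigma> x1"
  have "0 < s1" using x1 s0 by (simp add: s1_def)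
  have bound: "t - (s1 - s0) * (s0 powr (- b / 2) * W S s1) \<le> u x1" if S: "s1 < S" for S
  proof -
    have "0 < S" using S \<open>0 < s1\<close> by simp
    \<comment> \<open>Combines W \<ge> (K (S - s) / s0)^(-a), from ln x \<le> x - 1, with (S - s)^(1
      - a) \<ge> S^(1 - a) and s^(- b/2) \<ge> S^(- b/2).\<close>
    define C where "C = S powr (- b / 2) * ((K / s0) powr - a * S powr (1 - a))"
    have "0 < C" using \<open>0 < S\<close> s0 \<open>0 < K\<close> by (simp add: C_def)
    have blowup: "C / (S - s) \<le> f S s" if s: "s0 \<le> s" "s < S" for s
    proof -
      have "0 < s" using s s0 by simp
      have "ln (S / s) \<le> S / s - 1" using s \<open>0 < s\<close> by (intro ln_le_minus_one) simp
      also have "\<dots> = (S - s) / s" using \<open>0 < s\<close> by (simp add: field_simps)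
      also have "\<dots> \<le> (S - s) / s0" using s s0 by (intro divide_left_mono) auto
      finally have "K * ln (S / s) \<le> K / s0 * (S - s)"
        using \<open>0 < K\<close> mult_left_mono by fastforce
      then have "(K / s0 * (S - s)) powr - a \<le> W S s"
        unfolding W_def using pos[OF \<open>0 < s\<close> s(2)] \<open>1 \<le> a\<close> by (intro powr_mono2') auto
      moreover have "(K / s0 * (S - s)) powr - a = (K / s0) powr - a * (S - s) powr - a"
        by (rule powr_mult)
      moreover have "S powr (1 - a) / (S - s) \<le> (S - s) powr - a"
      proof -
        have "S powr (1 - a) \<le> (S - s) powr (1 - a)"
          using s \<open>0 < s\<close> \<open>1 \<le> a\<close> by (intro powr_mono2') auto
        also have "\<dots> = (S - s) powr - a * (S - s)"
          using s powr_add[of "S - s" "- a" 1] by (simp add: add.commute)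
        finally show ?thesis using s by (simp add: field_simps)
      qed
      then have "(K / s0) powr - a * (S powr (1 - a) / (S - s)) \<le> (K / s0) powr - a * (S - s) powr - a"
        by (intro mult_left_mono) auto
      ultimately have "(K / s0) powr - a * (S powr (1 - a) / (S - s)) \<le> W S s" by linarith
      moreover have "S powr (- b / 2) \<le> s powr (- b / 2)"
        using s \<open>0 < s\<close> b(2) by (intro powr_mono2') auto
      ultimately have "S powr (- b / 2) * ((K / s0) powr - a * (S powr (1 - a) / (S - s))) \<le> f S s"
        unfolding f_def using s by (intro mult_mono) auto
      then show ?thesis by (simp add: C_def)
    qed
    have "t - integral {s0..s1} (f S) \<le> u x1"
      unfolding s1_def \<sigma>_def
    proof (rule radial_comparison[where S = S and C = C, OF l ell F0 u u0 s0 _ _ strict \<open>0 < C\<close> blowup])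
      show "(f S has_real_derivative f' S s) (at s)" if "s0 \<le> s" "s < S" for s
        using f' that s0 by auto
      show "0 \<le> f S s" for s by (simp add: f_def W_def)
    qed (use sphere x1 S in \<open>auto simp: \<sigma>_def s1_def\<close>)
    \<comment> \<open>On this interval the power of \<open>s\<close> is largest at \<open>s0\<close>
      and \<open>W S\<close> is largest at \<open>s1\<close>.\<close>
    moreover have "integral {s0..s1} (f S) \<le> integral {s0..s1} (\<lambda>_. s0 powr (- b / 2) * W S s1)"
    proof (rule integral_le)
      have "continuous_on {s0..s1} (f S)"
        using f' s0 S by (intro DERIV_continuous_on[where D = "f' S"])
          (fastforce intro: has_field_derivative_at_within)
      then show "f S integrable_on {s0..s1}" by (rule integrable_continuous_interval)
      fix s assume s: "s \<in> {s0..s1}"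
      then have "0 < s" using s0 by simp
      have "ln (S / s1) \<le> ln (S / s)"
        using s \<open>0 < s\<close> S by (intro ln_mono divide_left_mono) auto
      then have "W S s \<le> W S s1"
        unfolding W_def using pos[OF \<open>0 < s1\<close> S] \<open>0 < K\<close> \<open>1 \<le> a\<close> by (intro powr_mono2') auto
      moreover have "s powr (- b / 2) \<le> s0 powr (- b / 2)"
        using s s0 b(2) by (intro powr_mono2') auto
      ultimately show "f S s \<le> s0 powr (- b / 2) * W S s1"
        unfolding f_def by (intro mult_mono) (auto simp: W_def)
    qed (rule integrable_const_ivl)
    moreover have "integral {s0..s1} (\<lambda>_. s0 powr (- b / 2) * W S s1) = (s1 - s0) * (s0 powr (- b / 2) * W S s1)"
      using x1 by (simp add: s1_def)
    ultimately show ?thesis by linarith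
  qed
  have "filterlim (\<lambda>S. K * ln (S / s1)) at_top at_top"
  proof -
    have "filterlim (\<lambda>S. 1 / s1 * S) at_top at_top"
      using \<open>0 < s1\<close> by (intro filterlim_tendsto_pos_mult_at_top[OF tendsto_const _ filterlim_ident]) simp
    then have "filterlim (\<lambda>S. ln (1 / s1 * S)) at_top at_top"
      by (rule filterlim_compose[OF ln_at_top])
    then show ?thesis
      using filterlim_tendsto_pos_mult_at_top[OF tendsto_const \<open>0 < K\<close>, of "\<lambda>S. ln (1 / s1 * S)" at_top] by simp
  qed
  then have "((\<lambda>S. W S s1) \<longlongrightarrow> 0) at_top"
    unfolding W_def using \<open>1 \<le> a\<close> by (intro tendsto_neg_powr) auto
  then have lim: "((\<lambda>S. t - (s1 - s0) * (s0 powr (- b / 2) * W S s1))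
      \<longlongrightarrow> t - (s1 - s0) * (s0 powr (- b / 2) * 0)) at_top"
    by (intro tendsto_intros)
  have "t - (s1 - s0) * (s0 powr (- b / 2) * 0) \<le> u x1"
    by (rule tendsto_upperbound[OF lim eventually_mono[OF eventually_gt_at_top[of s1]]])
      (simp_all only: bound trivial_limit_at_top_linorder not_False_eq_True)
  then show ?thesis by simp
qed

theorem theorem2p1:
  fixes F :: "real^'n \<Rightarrow> real^'n^'n \<Rightarrow> real"
    and u :: "real^'n \<Rightarrow> real"
    and l L q g :: real
  assumes "0 < l" and "l \<le> L"
    and "L / l * (real CARD('n) - 1) + 1 > 2"
    and "continuous_on (UNIV \<times> Sym) (\<lambda>(x, M). F x M)"
    and "uniformly_elliptic l L F"
    and "\<forall>x. F x 0 = 0"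
    and "q > (L / l * (real CARD('n) - 1) + 1) / ((L / l * (real CARD('n) - 1) + 1) - 2)"
    and "1 < g" and "g \<le> (L / l * (real CARD('n) - 1) + 1) / ((L / l * (real CARD('n) - 1) + 1) - 1)"
    and "\<forall>x. 0 \<le> u x"
    and "visc_super F q g u"
  shows "\<exists>c. \<forall>x. u x = c"
proof -
  have "u y \<le> u x" for x y
  proof (rule ccontr)
    assume "\<not> u y \<le> u x"
    then obtain t where t: "u x < t" "t < u y" using dense[of "u x" "u y"] by auto
    have "lsc u" using assms(11) by (simp add: visc_super_def)
    then have "\<forall>\<^sub>F z in at y. t < u z" using t(2) unfolding lsc_def by blast
    then obtain d where d: "d > 0" "\<And>z. z \<noteq> y \<Longrightarrow> dist z y < d \<Longrightarrow> t < u z"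
      unfolding eventually_at by auto
    have dist: "(z - y) \<bullet> (z - y) = (dist z y)\<^sup>2" for z
      by (simp add: dist_norm dot_square_norm)
    have near: "t < u z" if "dist z y < d" for z
      using d(2)[of z] t(2) that by (cases "z = y") auto
    have "t \<le> u x"
    proof (rule sphere_bound_imp_exterior_bound[OF assms(1,2,5,6,11,10) refl assms(3,8,9)])
      show "0 < (d / 2)\<^sup>2" using d(1) by simp
      show "t \<le> u z" if "(z - y) \<bullet> (z - y) = (d / 2)\<^sup>2" for z
      proof -
        have "dist z y = d / 2"
          using that d(1) unfolding dist by (simp add: power2_eq_iff_nonneg)
        then show ?thesis using near[of z] d(1) by simp
      qed
      \<comment> \<open>Within distance \<open>d\<close> of \<open>y\<close> the function exceeds t
        > u x, so \<open>x\<close> lies outside the sphere of radius d/2.\<close>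
      have "\<not> dist x y < d" using near[of x] t(1) by auto
      then show "(d / 2)\<^sup>2 \<le> (x - y) \<bullet> (x - y)"
        unfolding dist using d(1) by (intro power_mono) auto
    qed
    then show False using t(1) by simp
  qed
  then have "\<forall>x. u x = u 0" by (simp add: order_antisym)
  then show ?thesis by blast
qed

end
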